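(* Let $G$ be a transitive permutation group on a finite set $X$ containing an abelian semiregular subgroup $H$. Let $\Gamma$ be a $G$-invariant digraph on $X$ with an eigenvalue $\lambda$ which is not the valency of $\Gamma$. If the multiplicity of $\lambda$ as an eigenvalue of the quotient (multi)digraph $\Gamma/H$ is the same as the multiplicity of $\lambda$ as an eigenvalue of $\Gamma$, then there exists an intransitive normal subgroup of $G$ containing $H$.
   Context: Group actions are on the right. A permutation group $H$ on $X$ is semiregular if it is nontrivial and all its point stabilizers are trivial (so all its orbits have size $|H|$). A $G$-invariant digraph on $X$ is a digraph with vertex set $X$ and arc set a subset of $X\times X$ such that $G$ acts on it by automorphisms, i.e. the arc set is invariant under the diagonal action of $G$ on $X \times X$. Since $G$ is transitive, each vertex has the same number of in-neighbours and out-neighbours; this common number is the valency $\mathrm{val}(\Gamma)$ of $\Gamma$. Eigenvalues of a (multi)digraph are those of its adjacency matrix, and multiplicities are multiplicities as roots of the characteristic polynomial. For $H$-orbits $X_1,X_2$ (possibly equal), the number $m_{X_1,X_2}$ of arcs of $\Gamma$ starting at a fixed vertex of $X_1$ and ending in $X_2$ does not depend on the vertex chosen in $X_1$. The quotient $\Gamma/H$ is the (multi)digraph whose vertices are the $H$-orbits, with exactly $m_{X_1,X_2}$ arcs from $X_1$ to $X_2$; its adjacency matrix is $(m_{X_i,X_j})_{i,j}$. *)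

theory Defs
  imports "HOL-Algebra.Group_Action" "Jordan_Normal_Form.Char_Poly"
begin

text \<open>
  A permutation group on \<open>X\<close> is a subgroup \<open>K\<close> of the library group \<open>BijGroup X\<close>, acting on \<open>X\<close>
  by evaluation.  \<open>BijGroup\<close> composes functions from right to left, so it is the opposite of the
  group one gets when permutations act on the right; subgroups, normality, commutativity, orbits,
  stabilizers and invariant digraphs are the same for both.
\<close>

abbreviation perm_group :: "'a set \<Rightarrow> ('a \<Rightarrow> 'a) set \<Rightarrow> ('a \<Rightarrow> 'a) monoid" where
  "perm_group X K \<equiv> (BijGroup X)\<lparr>carrier := K\<rparr>"

abbreviation perm_transitive :: "'a set \<Rightarrow> ('a \<Rightarrow> 'a) set \<Rightarrow> bool" where
  "perm_transitive X K \<equiv> transitive_action (perm_group X K) X (\<lambda>g. g)"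

abbreviation perm_orbits :: "'a set \<Rightarrow> ('a \<Rightarrow> 'a) set \<Rightarrow> 'a set set" where
  "perm_orbits X K \<equiv> orbits (perm_group X K) X (\<lambda>g. g)"

definition semiregular :: "'a set \<Rightarrow> ('a \<Rightarrow> 'a) set \<Rightarrow> bool" where
  "semiregular X K \<longleftrightarrow>
     K \<noteq> {\<one>\<^bsub>BijGroup X\<^esub>} \<and>
     (\<forall>x\<in>X. stabilizer (perm_group X K) (\<lambda>g. g) x = {\<one>\<^bsub>BijGroup X\<^esub>})"

definition invariant_digraph :: "'a set \<Rightarrow> ('a \<Rightarrow> 'a) set \<Rightarrow> ('a \<times> 'a) set \<Rightarrow> bool" where
  "invariant_digraph X K \<Gamma> \<longleftrightarrow> \<Gamma> \<subseteq> X \<times> X \<and> (\<forall>g\<in>K. map_prod g g ` \<Gamma> = \<Gamma>)"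

text \<open>The common in- and out-degree; see \<open>valency_eq\<close> for well-definedness.\<close>

definition valency :: "'a set \<Rightarrow> ('a \<times> 'a) set \<Rightarrow> nat" where
  "valency X \<Gamma> = (THE d. \<forall>x\<in>X. card (\<Gamma> `` {x}) = d \<and> card (\<Gamma>\<inverse> `` {x}) = d)"

text \<open>
  A multidigraph is represented by its arc multiplicities \<open>m x y\<close>, the number of arcs from \<open>x\<close>
  to \<open>y\<close>.
\<close>

definition arc_mult :: "('a \<times> 'a) set \<Rightarrow> 'a \<Rightarrow> 'a \<Rightarrow> nat" where
  "arc_mult \<Gamma> x y = (if (x, y) \<in> \<Gamma> then 1 else 0)"

text \<open>
  Arc multiplicities of the quotient by a group whose orbits include \<open>A\<close> and \<open>B\<close>; see
  \<open>quotient_mult_eq\<close> for well-definedness.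
\<close>

definition quotient_mult :: "('a \<times> 'a) set \<Rightarrow> 'a set \<Rightarrow> 'a set \<Rightarrow> nat" where
  "quotient_mult \<Gamma> A B = (THE m. \<forall>x\<in>A. card {y \<in> B. (x, y) \<in> \<Gamma>} = m)"

text \<open>Rows and columns of the matrix follow an ordering \<open>vs\<close> of the vertex set.\<close>

definition adj_matrix :: "'v list \<Rightarrow> ('v \<Rightarrow> 'v \<Rightarrow> nat) \<Rightarrow> complex mat" where
  "adj_matrix vs m = mat (length vs) (length vs) (\<lambda>(i, j). of_nat (m (vs ! i) (vs ! j)))"

definition eig_mult :: "complex mat \<Rightarrow> complex \<Rightarrow> nat" where
  "eig_mult A ev = Polynomial.order ev (char_poly A)"


lemma subgroup_BijGroup_bij:
  assumes "subgroup K (BijGroup X)" "g \<in> K"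
  shows "bij_betw g X X"
  using subgroup.subset[OF assms(1)] assms(2) by (auto simp: BijGroup_def Bij_def)

lemma invariant_digraph_iff:
  assumes K: "subgroup K (BijGroup X)" and inv: "invariant_digraph X K \<Gamma>"
    and g: "g \<in> K" and x: "x \<in> X" and y: "y \<in> X"
  shows "(g x, g y) \<in> \<Gamma> \<longleftrightarrow> (x, y) \<in> \<Gamma>"
proof
  assume "(x, y) \<in> \<Gamma>"
  then have "map_prod g g (x, y) \<in> map_prod g g ` \<Gamma>" by (rule imageI)
  then show "(g x, g y) \<in> \<Gamma>"
    using inv g unfolding invariant_digraph_def by simp
next
  assume "(g x, g y) \<in> \<Gamma>"
  then have "(g x, g y) \<in> map_prod g g ` \<Gamma>"
    using inv g unfolding invariant_digraph_def by simp
  then obtain a b where ab: "(a, b) \<in> \<Gamma>" "g a = g x" "g b = g y" by auto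
  moreover have "a \<in> X" "b \<in> X" using ab inv unfolding invariant_digraph_def by auto
  ultimately show "(x, y) \<in> \<Gamma>"
    using subgroup_BijGroup_bij[OF K g] x y unfolding bij_betw_def by (metis inj_onD)
qed

lemma valency_eq:
  assumes fin: "finite X" and K: "subgroup K (BijGroup X)" and tr: "perm_transitive X K"
    and inv: "invariant_digraph X K \<Gamma>" and x: "x \<in> X"
  shows "card (\<Gamma> `` {x}) = valency X \<Gamma>" "card (\<Gamma>\<inverse> `` {x}) = valency X \<Gamma>"
proof -
  have sub: "\<Gamma> \<subseteq> X \<times> X" using inv unfolding invariant_digraph_def by simp
  then have finG: "finite \<Gamma>" using fin finite_subset by blast
  have const: "card (\<Gamma> `` {y}) = card (\<Gamma> `` {x}) \<and> card (\<Gamma>\<inverse> `` {y}) = card (\<Gamma>\<inverse> `` {x})"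
    if y: "y \<in> X" for y
  proof -
    obtain g where g: "g \<in> K" "g x = y"
      using transitive_action.unique_orbit[OF tr x y] by auto
    have bij: "bij_betw g X X" by (rule subgroup_BijGroup_bij[OF K g(1)])
    have surj: "\<exists>w\<in>X. g w = z" if "z \<in> X" for z
      using bij that unfolding bij_betw_def by (metis imageE)
    have "\<Gamma> `` {y} = g ` (\<Gamma> `` {x})"
    proof (intro Set.set_eqI iffI)
      fix z assume z: "z \<in> \<Gamma> `` {y}"
      then obtain w where "w \<in> X" "g w = z" using surj[of z] sub by auto
      then show "z \<in> g ` (\<Gamma> `` {x})"
        using z invariant_digraph_iff[OF K inv g(1) x, of w] g(2) by auto
    next
      fix z assume "z \<in> g ` (\<Gamma> `` {x})"
      then obtain w where "(x, w) \<in> \<Gamma>" "z = g w" by auto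
      then show "z \<in> \<Gamma> `` {y}"
        using invariant_digraph_iff[OF K inv g(1) x, of w] g(2) sub by auto
    qed
    moreover have "\<Gamma>\<inverse> `` {y} = g ` (\<Gamma>\<inverse> `` {x})"
    proof (intro Set.set_eqI iffI)
      fix z assume z: "z \<in> \<Gamma>\<inverse> `` {y}"
      then obtain w where "w \<in> X" "g w = z" using surj[of z] sub by auto
      then show "z \<in> g ` (\<Gamma>\<inverse> `` {x})"
        using z invariant_digraph_iff[OF K inv g(1) _ x, of w] g(2) by auto
    next
      fix z assume "z \<in> g ` (\<Gamma>\<inverse> `` {x})"
      then obtain w where "(w, x) \<in> \<Gamma>" "z = g w" by auto
      then show "z \<in> \<Gamma>\<inverse> `` {y}"
        using invariant_digraph_iff[OF K inv g(1) _ x, of w] g(2) sub by auto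
    qed
    moreover have "inj_on g (\<Gamma> `` {x})" "inj_on g (\<Gamma>\<inverse> `` {x})"
      using bij sub unfolding bij_betw_def by (auto intro: inj_on_subset)
    ultimately show ?thesis by (simp add: card_image)
  qed
  have fibre_sum: "card R = (\<Sum>z\<in>X. card (R `` {z}))" if "R \<subseteq> X \<times> X" for R :: "('a \<times> 'a) set"
  proof -
    have "R = (SIGMA z:X. R `` {z})" using that by auto
    moreover have "finite (R `` {z})" for z
      by (rule finite_subset[OF _ fin]) (use that in auto)
    ultimately show ?thesis using card_SigmaI[OF fin, of "\<lambda>z. R `` {z}"] by simp
  qed
  have "card X * card (\<Gamma> `` {x}) = (\<Sum>z\<in>X. card (\<Gamma> `` {z}))"
  proof -
    have "(\<Sum>z\<in>X. card (\<Gamma> `` {z})) = (\<Sum>z\<in>X. card (\<Gamma> `` {x}))"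
      by (rule sum.cong) (use const in blast)+
    then show ?thesis by simp
  qed
  also have "\<dots> = card \<Gamma>" using fibre_sum[OF sub] by simp
  also have "\<dots> = card (\<Gamma>\<inverse>)" by (simp add: card_inverse)
  also have "\<dots> = (\<Sum>z\<in>X. card (\<Gamma>\<inverse> `` {z}))" by (rule fibre_sum) (use sub in auto)
  also have "\<dots> = card X * card (\<Gamma>\<inverse> `` {x})"
  proof -
    have "(\<Sum>z\<in>X. card (\<Gamma>\<inverse> `` {z})) = (\<Sum>z\<in>X. card (\<Gamma>\<inverse> `` {x}))"
      by (rule sum.cong) (use const in blast)+
    then show ?thesis by simp
  qed
  finally have eq: "card (\<Gamma> `` {x}) = card (\<Gamma>\<inverse> `` {x})"
    using x fin by (auto simp: card_gt_0_iff)
  have "valency X \<Gamma> = card (\<Gamma> `` {x})"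
    unfolding valency_def
  proof (rule the_equality)
    show "\<forall>y\<in>X. card (\<Gamma> `` {y}) = card (\<Gamma> `` {x}) \<and> card (\<Gamma>\<inverse> `` {y}) = card (\<Gamma> `` {x})"
      using const eq by metis
  qed (use x in metis)
  then show "card (\<Gamma> `` {x}) = valency X \<Gamma>" "card (\<Gamma>\<inverse> `` {x}) = valency X \<Gamma>"
    using eq by simp_all
qed

lemma quotient_mult_eq:
  assumes K: "subgroup K (BijGroup X)" and inv: "invariant_digraph X K \<Gamma>"
    and A: "A \<in> perm_orbits X K" and B: "B \<in> perm_orbits X K" and x: "x \<in> A"
  shows "card {y \<in> B. (x, y) \<in> \<Gamma>} = quotient_mult \<Gamma> A B"
proof -
  interpret group_action "perm_group X K" X "\<lambda>g. g"
  proof (rule group_action.intro)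
    show "group_hom (perm_group X K) (BijGroup X) (\<lambda>g. g)"
      using group_BijGroup[of X] subgroup.subset[OF K] group.subgroup_imp_group[OF group_BijGroup K]
      by (auto simp: group_hom_def group_hom_axioms_def hom_def)
  qed
  have closed: "g x \<in> X" if "g \<in> K" "x \<in> X" for g x
    using bij_betwE[OF subgroup_BijGroup_bij[OF K that(1)]] that(2) by blast
  have BX: "B \<subseteq> X" using B closed by (auto simp: orbits_def orbit_def)
  have AX: "A \<subseteq> X" using A closed by (auto simp: orbits_def orbit_def)
  have same: "\<exists>g\<in>K. g a = b" if C: "C \<in> perm_orbits X K" and ab: "a \<in> C" "b \<in> C" for C a b
  proof -
    obtain c where c: "c \<in> X" "C = orbit (perm_group X K) (\<lambda>g. g) c"
      using C by (auto simp: orbits_def)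
    have "a \<in> X" "b \<in> X" using ab c closed by (auto simp: orbit_def)
    then have "b \<in> orbit (perm_group X K) (\<lambda>g. g) a"
      using ab c(2) orbit_trans[OF \<open>a \<in> X\<close> c(1) \<open>b \<in> X\<close>] orbit_sym[OF c(1) \<open>a \<in> X\<close>] by simp
    then show ?thesis by (auto simp: orbit_def)
  qed
  have img: "g b \<in> B" if g: "g \<in> K" and b: "b \<in> B" for g b
  proof -
    obtain c where c: "c \<in> X" "B = orbit (perm_group X K) (\<lambda>g. g) c"
      using B by (auto simp: orbits_def)
    have bX: "b \<in> X" using b BX by auto
    have "g b \<in> orbit (perm_group X K) (\<lambda>g. g) b" using g by (auto simp: orbit_def)
    then show ?thesis using orbit_trans[OF c(1) bX closed[OF g bX]] b c(2) by simp
  qed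
  have le: "card {y \<in> B. (a, y) \<in> \<Gamma>} = card {y \<in> B. (b, y) \<in> \<Gamma>}"
    if a: "a \<in> A" and b: "b \<in> A" for a b
  proof -
    obtain g where g: "g \<in> K" "g a = b" using same[OF A a b] by blast
    have aX: "a \<in> X" using a AX by auto
    have bij: "bij_betw g X X" by (rule subgroup_BijGroup_bij[OF K g(1)])
    have "{y \<in> B. (b, y) \<in> \<Gamma>} = g ` {y \<in> B. (a, y) \<in> \<Gamma>}"
    proof (intro Set.set_eqI iffI)
      fix z assume z: "z \<in> {y \<in> B. (b, y) \<in> \<Gamma>}"
      then obtain w where w: "w \<in> X" "g w = z"
        using BX bij_betw_imp_surj_on[OF bij] by (metis (mono_tags, lifting) imageE mem_Collect_eq subsetD)
      obtain h where h: "h \<in> K" "h z = w"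
      proof
        show "inv\<^bsub>perm_group X K\<^esub> g \<in> K"
          using group.inv_closed[OF group.subgroup_imp_group[OF group_BijGroup K]] g(1) by simp
        show "(inv\<^bsub>perm_group X K\<^esub> g) z = w"
          using orbit_sym_aux[of g w z] w g(1) by simp
      qed
      have "w \<in> B" using img[OF h(1)] h(2) z by blast
      then show "z \<in> g ` {y \<in> B. (a, y) \<in> \<Gamma>}"
        using z w g(2) invariant_digraph_iff[OF K inv g(1) aX w(1)] by auto
    next
      fix z assume "z \<in> g ` {y \<in> B. (a, y) \<in> \<Gamma>}"
      then obtain w where w: "w \<in> B" "(a, w) \<in> \<Gamma>" "z = g w" by auto
      moreover have "w \<in> X" using w(1) BX by auto
      ultimately show "z \<in> {y \<in> B. (b, y) \<in> \<Gamma>}"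
        using invariant_digraph_iff[OF K inv g(1) aX, of w] g(2) img[OF g(1) w(1)] by auto
    qed
    moreover have "inj_on g {y \<in> B. (a, y) \<in> \<Gamma>}"
      using bij BX unfolding bij_betw_def by (auto intro: inj_on_subset)
    ultimately show ?thesis by (simp add: card_image)
  qed
  have "quotient_mult \<Gamma> A B = card {y \<in> B. (x, y) \<in> \<Gamma>}"
    unfolding quotient_mult_def
  proof (rule the_equality)
    show "\<forall>a\<in>A. card {y \<in> B. (a, y) \<in> \<Gamma>} = card {y \<in> B. (x, y) \<in> \<Gamma>}"
      using le x by blast
  qed (use x in metis)
  then show ?thesis by simp
qed

end

theory Submission
  imports Defs "HOL-Library.Disjoint_Sets"
begin

text \<open>
  Take \<open>N\<close> to be the kernel of \<open>G\<close> acting on the \<open>ev\<close>-eigenfunctions of \<open>\<Gamma>\<close>; it is normal, and if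
  it were transitive, the eigenfunctions would be constant and \<open>ev\<close> would be the valency.
  The functions constant on \<open>H\<close>-orbits form an invariant subspace on which the adjacency matrix
  acts as the quotient matrix.  Equality of the multiplicities says that \<open>ev\<close> is not an eigenvalue
  on the quotient space, so every eigenfunction is constant on \<open>H\<close>-orbits, that is, \<open>H \<subseteq> N\<close>.
\<close>

section \<open>Eigenvalues of block upper triangular matrices\<close>

text \<open>The characteristic matrix inherits the zero block, and the determinant of a block
  triangular matrix is the product of the determinants of its diagonal blocks.\<close>

lemma char_poly_block_upper_triangular:
  fixes Q R :: "'b :: field mat"
  assumes Q: "Q \<in> carrier_mat k k" and B: "B \<in> carrier_mat k m" and R: "R \<in> carrier_mat m m"
  shows "char_poly (four_block_mat Q B (0\<^sub>m m k) R) = char_poly Q * char_poly R"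
proof -
  \<comment> \<open>\<open>?cm A\<close> is the characteristic matrix with the entries of
    \<open>A\<close> turned into constant polynomials, so that the blocks can be compared
    entrywise.\<close>
  let ?cm = "\<lambda>A :: 'b mat. [:0, 1:] \<cdot>\<^sub>m 1\<^sub>m (dim_row A) + map_mat (\<lambda>a. [:- a:]) A"
  let ?B = "map_mat (\<lambda>a. [:- a:]) B"
  have "?cm (four_block_mat Q B (0\<^sub>m m k) R) = four_block_mat (?cm Q) ?B (0\<^sub>m m k) (?cm R)"
    by (rule eq_matI) (use assms in \<open>auto simp: one_poly_def\<close>)
  moreover have "det (four_block_mat (?cm Q) ?B (0\<^sub>m m k) (?cm R)) = det (?cm Q) * det (?cm R)"
    by (rule det_four_block_mat_lower_left_zero) (use assms in auto)
  ultimately show ?thesis unfolding char_poly_defs by simp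
qed

text \<open>Orders of roots add over the product of the characteristic polynomials of
  \<open>Q\<close> and \<open>R\<close>, so \<open>ord\<close> leaves order 0 for \<open>R\<close>:
  \<open>ev\<close> is not an eigenvalue of \<open>R\<close>. The lower part of \<open>w\<close>
  satisfies the eigenvalue equation of \<open>R\<close> and must therefore vanish.\<close>

lemma eigenvector_block_upper_triangular:
  fixes Q R :: "'b :: field mat"
  assumes Q: "Q \<in> carrier_mat k k" and B: "B \<in> carrier_mat k m" and R: "R \<in> carrier_mat m m"
    and M: "M = four_block_mat Q B (0\<^sub>m m k) R"
    and ord: "Polynomial.order ev (char_poly Q) = Polynomial.order ev (char_poly M)"
    and w: "w \<in> carrier_vec (k + m)" and Mw: "M *\<^sub>v w = ev \<cdot>\<^sub>v w"
    and i: "k \<le> i" "i < k + m"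
  shows "w $ i = 0"
proof -
  define w2 where "w2 = vec_last w m"
  have w2: "w2 \<in> carrier_vec m" unfolding w2_def by simp
  have w12: "w = vec_first w k @\<^sub>v w2"
    unfolding w2_def using w by simp
  have "M *\<^sub>v w = (Q *\<^sub>v vec_first w k + B *\<^sub>v w2) @\<^sub>v (0\<^sub>m m k *\<^sub>v vec_first w k + R *\<^sub>v w2)"
    unfolding M by (subst w12, rule four_block_mat_mult_vec[OF Q B _ R]) (use w2 in auto)
  moreover have "ev \<cdot>\<^sub>v w = (ev \<cdot>\<^sub>v vec_first w k) @\<^sub>v (ev \<cdot>\<^sub>v w2)"
    by (subst w12) (rule eq_vecI, auto)
  ultimately have "(Q *\<^sub>v vec_first w k + B *\<^sub>v w2) @\<^sub>v (0\<^sub>m m k *\<^sub>v vec_first w k + R *\<^sub>v w2)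
      = (ev \<cdot>\<^sub>v vec_first w k) @\<^sub>v (ev \<cdot>\<^sub>v w2)"
    using Mw by (simp only:)
  then have "0\<^sub>m m k *\<^sub>v vec_first w k + R *\<^sub>v w2 = ev \<cdot>\<^sub>v w2"
    by (subst (asm) append_vec_eq[of _ k]) (use Q B w2 in auto)
  moreover have "0\<^sub>m m k *\<^sub>v vec_first w k = 0\<^sub>v m" by (intro eq_vecI) (auto simp: scalar_prod_def)
  ultimately have Rw: "R *\<^sub>v w2 = ev \<cdot>\<^sub>v w2" using R w2 by simp
  \<comment> \<open>Additivity of the order needs a nonzero product; characteristic polynomials are
    monic.\<close>
  have nz: "char_poly Q \<noteq> 0" "char_poly R \<noteq> 0"
    using degree_monic_char_poly[OF Q] degree_monic_char_poly[OF R] by auto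
  then have "Polynomial.order ev (char_poly R) = 0"
    using ord unfolding M char_poly_block_upper_triangular[OF Q B R] by (simp add: order_mult)
  then have "\<not> eigenvalue R ev"
    using eigenvalue_root_char_poly[OF R] nz(2) order_root by blast
  then have "w2 = 0\<^sub>v m"
    using Rw w2 R unfolding eigenvalue_def eigenvector_def by auto
  then have "w2 $ (i - k) = 0" using i by simp
  moreover have "w2 $ (i - k) = w $ i" using i w unfolding w2_def vec_last_def by auto
  ultimately show ?thesis by simp
qed

section \<open>Eigenfunctions and equitable partitions\<close>

text \<open>In a basis that starts with the block indicators, the adjacency matrix is block upper
  triangular with the quotient matrix in the upper left corner. By the previous lemma the remaining
  coordinates of \<open>f\<close> vanish, and these are the differences between \<open>f\<close> at
  a vertex and at the representative of its block. The only property of orbits that this uses is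
  that arc counts into a block are constant on blocks.\<close>

lemma eigenfunction_const_on_equitable_partition:
  fixes m :: "'a \<Rightarrow> 'a \<Rightarrow> nat" and f :: "'a \<Rightarrow> complex"
  assumes vs: "distinct vs" "set vs = X" and os: "distinct os" "set os = P"
    and part: "partition_on X P"
    and equitable: "\<And>A B x. A \<in> P \<Longrightarrow> B \<in> P \<Longrightarrow> x \<in> A \<Longrightarrow> (\<Sum>y\<in>B. m x y) = q A B"
    and mult: "eig_mult (adj_matrix os q) ev = eig_mult (adj_matrix vs m) ev"
    and f: "\<And>x. x \<in> X \<Longrightarrow> (\<Sum>y\<in>X. of_nat (m x y) * f y) = ev * f x"
    and A: "A \<in> P" "x \<in> A" "y \<in> A"
  shows "f x = f y"
proof -
  have finX: "finite X" using vs by auto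
  define r where "r B = (SOME x. x \<in> B)" for B :: "'a set"
  have r: "r B \<in> B" if "B \<in> P" for B
  proof -
    have "B \<noteq> {}" using that part by (auto simp: partition_on_def)
    then show ?thesis unfolding r_def by (simp add: some_in_eq)
  qed
  have sub: "B \<subseteq> X" if "B \<in> P" for B using that part by (auto simp: partition_on_def)
  have same: "B = C" if "B \<in> P" "C \<in> P" "z \<in> B" "z \<in> C" for B C z
    using that part by (auto simp: partition_on_def disjoint_def)
  define b where "b z = (THE B. B \<in> P \<and> z \<in> B)" for z
  have b_eq: "b z = B" if "B \<in> P" "z \<in> B" for B z
    unfolding b_def by (rule the_equality) (use that same in auto)
  have b: "b z \<in> P \<and> z \<in> b z" if z: "z \<in> X" for z
  proof -
    obtain B where "B \<in> P" "z \<in> B" using z partition_onD1[OF part] by auto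
    then show ?thesis using b_eq by auto
  qed
  \<comment> \<open>A second ordering of \<open>X\<close>: first the block representatives, in the
    order of \<open>os\<close>, then all other vertices. Position \<open>i < k\<close> thus belongs
    to the block \<open>os ! i\<close>.\<close>
  define us where "us = map r os @ filter (\<lambda>z. z \<notin> r ` P) vs"
  define n where "n = length vs"
  define k where "k = length os"
  have inj_r: "inj_on r P" using r same by (metis inj_onI)
  have set_us: "set us = X" unfolding us_def using vs os r sub by auto
  have dist_us: "distinct us" unfolding us_def using vs os inj_r by (auto simp: distinct_map)
  have len: "length us = n"
    using distinct_card[OF dist_us] distinct_card[OF vs(1)] set_us vs(2) n_def by simp
  have kn: "k \<le> n" using len unfolding us_def k_def by simp
  have us_lt: "us ! i = r (os ! i)" if "i < k" for i
    using that unfolding us_def k_def by (simp add: nth_append)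
  have os_in: "os ! i \<in> P" if "i < k" for i using that os k_def by auto
  have us_in: "us ! i \<in> X" if "i < n" for i using that set_us len nth_mem by metis
  have vs_in: "vs ! i \<in> X" if "i < n" for i using that vs n_def nth_mem by metis
  have us_eq: "us ! i = us ! j \<longleftrightarrow> i = j" if "i < n" "j < n" for i j
    using that nth_eq_iff_index_eq[OF dist_us] len by simp
  have us_ge: "us ! i \<notin> r ` P" if "k \<le> i" "i < n" for i
  proof -
    have "us ! i = filter (\<lambda>z. z \<notin> r ` P) vs ! (i - k)" "i - k < length (filter (\<lambda>z. z \<notin> r ` P) vs)"
      using that len unfolding us_def k_def by (auto simp: nth_append)
    then have "us ! i \<in> set (filter (\<lambda>z. z \<notin> r ` P) vs)" by (metis nth_mem)
    then show ?thesis by simp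
  qed
  \<comment> \<open>\<open>\<phi>\<close> is a basis of functions that starts with the indicators of the blocks, and \<open>\<tau>\<close> is its dual
    basis; a function \<open>g\<close> is constant on blocks iff \<open>\<tau> i g = 0\<close> for all \<open>i \<ge> k\<close>.\<close>
  define \<phi> :: "nat \<Rightarrow> 'a \<Rightarrow> complex" where
    "\<phi> j z = of_bool (if j < k then z \<in> os ! j else z = us ! j)" for j z
  define \<tau> :: "nat \<Rightarrow> ('a \<Rightarrow> complex) \<Rightarrow> complex" where
    "\<tau> i g = g (us ! i) - (if i < k then 0 else g (r (b (us ! i))))" for i g
  have rb: "r (b z) \<in> X" "r (b z) \<in> b z" if "z \<in> X" for z
    using b[OF that] r sub by blast+
  have b_rb: "b (r (b z)) = b z" if "z \<in> X" for z
    using b_eq b[OF that] rb(2)[OF that] by blast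
  \<comment> \<open>For \<open>j < k\<close>, \<open>\<phi> j\<close> agrees at a vertex and at its
    representative, so every \<open>\<tau> i\<close> with \<open>i \<ge> k\<close> kills it. For
    \<open>j \<ge> k\<close>, \<open>\<phi> j\<close> is concentrated at a vertex that represents no
    block, so the correction term in \<open>\<tau> i\<close> is zero.\<close>
  have dual: "\<tau> i (\<phi> j) = of_bool (i = j)" if i: "i < n" and j: "j < n" for i j
  proof (cases "j < k")
    case True
    have z: "z \<in> os ! j \<longleftrightarrow> b z = os ! j" if "z \<in> X" for z
      using b[OF that] b_eq os_in[OF True] by auto
    show ?thesis
    proof (cases "i < k")
      case True
      have "us ! i \<in> os ! j \<longleftrightarrow> i = j"
        using same[OF os_in[OF True] os_in[OF \<open>j < k\<close>]] r[OF os_in[OF True]] us_lt[OF True]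
          nth_eq_iff_index_eq[OF os(1)] True \<open>j < k\<close> k_def by metis
      then show ?thesis using True \<open>j < k\<close> by (simp add: \<tau>_def \<phi>_def)
    next
      case False
      have "us ! i \<in> os ! j \<longleftrightarrow> r (b (us ! i)) \<in> os ! j"
        using z[OF us_in[OF i]] z[OF rb(1)[OF us_in[OF i]]] b_rb[OF us_in[OF i]] by simp
      then show ?thesis using False \<open>j < k\<close> by (auto simp: \<tau>_def \<phi>_def)
    qed
  next
    case False
    then have "r (b (us ! i)) \<noteq> us ! j"
      using us_ge[of j] j b[OF us_in[OF i]] by (metis imageI not_le)
    then show ?thesis using False us_eq[OF i j] by (simp add: \<tau>_def \<phi>_def)
  qed
  have sum_vs: "(\<Sum>l = 0..<n. g (vs ! l)) = (\<Sum>y\<in>X. g y)" for g :: "'a \<Rightarrow> complex"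
    by (rule sum.reindex_bij_betw) (use bij_betw_nth[OF vs(1)] vs n_def in \<open>auto simp: atLeast0LessThan\<close>)
  have pick: "(\<Sum>l = 0..<n. of_bool (z = vs ! l) * g (vs ! l)) = g z" if "z \<in> X" for z and g :: "'a \<Rightarrow> complex"
    using that finX by (subst sum_vs) (simp add: of_bool_def if_distrib[of "\<lambda>c. c * _"] cong: if_cong)
  \<comment> \<open>The columns of \<open>S\<close> are the \<open>\<phi> j\<close> and the rows of
    \<open>T\<close> are the \<open>\<tau> i\<close>, both written in the vertex order
    \<open>vs\<close>. Duality then says that \<open>T\<close> is the inverse of
    \<open>S\<close>.\<close>
  define S where "S = mat n n (\<lambda>(l, j). \<phi> j (vs ! l))"
  define T where "T = mat n n (\<lambda>(i, l). of_bool (us ! i = vs ! l)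
    - (if i < k then 0 else of_bool (r (b (us ! i)) = vs ! l)) :: complex)"
  define Adj where "Adj = adj_matrix vs m"
  have S: "S \<in> carrier_mat n n" and T: "T \<in> carrier_mat n n" and Adj: "Adj \<in> carrier_mat n n"
    by (auto simp: S_def T_def Adj_def adj_matrix_def n_def)
  have T_sum: "(\<Sum>l = 0..<n. T $$ (i, l) * g (vs ! l)) = \<tau> i g" if i: "i < n" for i g
  proof -
    have "(\<Sum>l = 0..<n. T $$ (i, l) * g (vs ! l)) = (\<Sum>l = 0..<n. of_bool (us ! i = vs ! l) * g (vs ! l)
      - (if i < k then 0 else of_bool (r (b (us ! i)) = vs ! l) * g (vs ! l)))"
      by (rule sum.cong) (use i in \<open>auto simp: T_def algebra_simps\<close>)
    also have "\<dots> = \<tau> i g"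
      using pick[OF us_in[OF i]] pick[OF rb(1)[OF us_in[OF i]]]
      by (simp add: sum_subtractf \<tau>_def)
    finally show ?thesis .
  qed
  have T_mult: "(T * mat n n (\<lambda>(l, j). F j (vs ! l))) $$ (i, j) = \<tau> i (F j)"
    if "i < n" "j < n" for F i j
    using T_sum[OF that(1), of "F j"] that T by (simp add: scalar_prod_def)
  have TS: "T * S = 1\<^sub>m n"
    by (rule eq_matI) (use T_mult dual S T in \<open>auto simp: S_def\<close>)
  then have ST: "S * T = 1\<^sub>m n" by (rule mat_mult_left_right_inverse[OF T S])
  \<comment> \<open>\<open>F j\<close> is the image of \<open>\<phi> j\<close> under the adjacency
    operator.\<close>
  define F where "F j z = (\<Sum>y\<in>X. of_nat (m z y) * \<phi> j y)" for j z
  have AS: "Adj * S = mat n n (\<lambda>(l, j). F j (vs ! l))"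
  proof (rule eq_matI)
    fix l j assume "l < dim_row (mat n n (\<lambda>(l, j). F j (vs ! l)))" "j < dim_col (mat n n (\<lambda>(l, j). F j (vs ! l)))"
    then have lj: "l < n" "j < n" by auto
    have "(Adj * S) $$ (l, j) = (\<Sum>i = 0..<n. of_nat (m (vs ! l) (vs ! i)) * \<phi> j (vs ! i))"
      using lj by (simp add: Adj_def adj_matrix_def S_def scalar_prod_def n_def)
    then show "(Adj * S) $$ (l, j) = mat n n (\<lambda>(l, j). F j (vs ! l)) $$ (l, j)"
      using lj sum_vs[of "\<lambda>y. of_nat (m (vs ! l) y) * \<phi> j y"] by (simp add: F_def)
  qed (use Adj S in auto)
  \<comment> \<open>The adjacency operator in the basis \<open>\<phi>\<close>.\<close>
  define M where "M = T * (Adj * S)"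
  have M: "M \<in> carrier_mat n n" unfolding M_def using T Adj S by auto
  have M_index: "M $$ (i, j) = \<tau> i (F j)" if "i < n" "j < n" for i j
    unfolding M_def AS using T_mult that by blast
  \<comment> \<open>Equitability enters here: the operator maps a block indicator to a function that
    is constant on blocks. This determines the first \<open>k\<close> columns of
    \<open>M\<close>.\<close>
  have F_block: "F j z = of_nat (q (b z) (os ! j))" if j: "j < k" and z: "z \<in> X" for j z
  proof -
    have "F j z = (\<Sum>y\<in>os ! j. of_nat (m z y))"
      unfolding F_def \<phi>_def using j sub[OF os_in[OF j]] finX
      by (intro sum.mono_neutral_cong_right) auto
    also have "\<dots> = of_nat (q (b z) (os ! j))"
      using equitable[of "b z" "os ! j" z] b[OF z] os_in[OF j] by (metis of_nat_sum)
    finally show ?thesis .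
  qed
  obtain Q B Z R where split: "split_block M k k = (Q, B, Z, R)" by (metis prod_cases4)
  note blk = split_block[OF split, of "n - k" "n - k"]
  have QBZR: "Q \<in> carrier_mat k k" "B \<in> carrier_mat k (n - k)" "Z \<in> carrier_mat (n - k) k"
    "R \<in> carrier_mat (n - k) (n - k)" "M = four_block_mat Q B Z R"
    using blk M kn by auto
  \<comment> \<open>For \<open>i < k\<close>, \<open>\<tau> i\<close> is evaluation at the
    representative of \<open>os ! i\<close>, so the corner consists of the quotient
    multiplicities.\<close>
  have Q_eq: "Q = adj_matrix os q"
  proof (rule eq_matI)
    fix i j assume "i < dim_row (adj_matrix os q)" "j < dim_col (adj_matrix os q)"
    then have ij: "i < k" "j < k" by (auto simp: adj_matrix_def k_def)
    have "Q $$ (i, j) = M $$ (i, j)" using ij QBZR by simp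
    also have "\<dots> = F j (us ! i)" using M_index[of i j] ij kn by (simp add: \<tau>_def)
    also have "\<dots> = of_nat (q (os ! i) (os ! j))"
      using F_block[OF ij(2) us_in[of i]] b_eq[OF os_in[OF ij(1)] r[OF os_in[OF ij(1)]]] us_lt[OF ij(1)]
        ij kn by simp
    finally show "Q $$ (i, j) = adj_matrix os q $$ (i, j)" using ij by (simp add: adj_matrix_def k_def)
  qed (use QBZR in \<open>auto simp: adj_matrix_def k_def\<close>)
  \<comment> \<open>For rows from \<open>k\<close> on, \<open>\<tau>\<close> takes the difference of
    two values of \<open>F j\<close> on the same block.\<close>
  have Z_eq: "Z = 0\<^sub>m (n - k) k"
  proof (rule eq_matI)
    fix i j assume "i < dim_row (0\<^sub>m (n - k) k :: complex mat)" "j < dim_col (0\<^sub>m (n - k) k :: complex mat)"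
    then have ij: "k + i < n" "j < k" by auto
    have u: "us ! (k + i) \<in> X" using us_in ij by simp
    have "Z $$ (i, j) = M $$ (k + i, j)" using ij QBZR kn by simp
    also have "\<dots> = F j (us ! (k + i)) - F j (r (b (us ! (k + i))))"
      using M_index[of "k + i" j] ij kn by (simp add: \<tau>_def)
    also have "\<dots> = 0"
      using F_block[OF ij(2) u] F_block[OF ij(2) rb(1)[OF u]] b_rb[OF u] by simp
    finally show "Z $$ (i, j) = 0\<^sub>m (n - k) k $$ (i, j)" using ij by simp
  qed (use QBZR in auto)
  have "Adj = S * M * T"
  proof -
    have "S * M * T = (S * T) * Adj * (S * T)"
      unfolding M_def using S T Adj by (simp add: assoc_mult_mat[of _ n n _ n _ n])
    then show ?thesis using ST Adj by simp
  qed
  then have "similar_mat Adj M"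
    using similar_matI[of Adj M S T n] S T Adj M ST TS by auto
  \<comment> \<open>Similar matrices have the same characteristic polynomial, so \<open>mult\<close>
    becomes a statement about \<open>M\<close> and its corner \<open>Q\<close>.\<close>
  then have ord: "Polynomial.order ev (char_poly Q) = Polynomial.order ev (char_poly M)"
    using mult char_poly_similar[of Adj M] unfolding eig_mult_def Q_eq Adj_def by simp
  define v where "v = vec n (\<lambda>l. f (vs ! l))"
  have v: "v \<in> carrier_vec n" unfolding v_def by simp
  have Av: "Adj *\<^sub>v v = ev \<cdot>\<^sub>v v"
  proof (rule eq_vecI)
    fix l assume "l < dim_vec (ev \<cdot>\<^sub>v v)"
    then have l: "l < n" by (simp add: v_def)
    have "(Adj *\<^sub>v v) $ l = (\<Sum>i = 0..<n. of_nat (m (vs ! l) (vs ! i)) * f (vs ! i))"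
      using l by (simp add: Adj_def adj_matrix_def v_def scalar_prod_def n_def)
    then show "(Adj *\<^sub>v v) $ l = (ev \<cdot>\<^sub>v v) $ l"
      using l sum_vs[of "\<lambda>y. of_nat (m (vs ! l) y) * f y"] f[OF vs_in[OF l]] by (simp add: v_def)
  qed (use Adj v in auto)
  \<comment> \<open>The coordinates of \<open>f\<close> in the basis \<open>\<phi>\<close>; entry
    \<open>i\<close> is \<open>\<tau> i f\<close>.\<close>
  define w where "w = T *\<^sub>v v"
  have w: "w \<in> carrier_vec n" unfolding w_def using T v by auto
  have "S *\<^sub>v w = v"
    unfolding w_def using S T v ST assoc_mult_mat_vec[OF S T v] by simp
  then have "M *\<^sub>v w = T *\<^sub>v (Adj *\<^sub>v v)"
    unfolding M_def using T Adj S w by (simp add: assoc_mult_mat_vec[of _ n n _ n])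
  then have Mw: "M *\<^sub>v w = ev \<cdot>\<^sub>v w"
    unfolding Av w_def using T v by (simp add: mult_mat_vec)
  have tau0: "\<tau> i f = 0" if i: "k \<le> i" "i < n" for i
  proof -
    have "w $ i = \<tau> i f"
      unfolding w_def using i T_sum[of i f] T by (simp add: scalar_prod_def v_def)
    moreover have "w $ i = 0"
      by (rule eigenvector_block_upper_triangular[OF QBZR(1,2,4) _ ord _ Mw])
        (use QBZR(5) Z_eq w i kn in auto)
    ultimately show ?thesis by simp
  qed
  \<comment> \<open>A vertex of \<open>B\<close> listed before position \<open>k\<close> is
    \<open>r B\<close> itself; for any other vertex \<open>tau0\<close> is exactly the
    claim.\<close>
  have f_rep: "f z = f (r B)" if z: "B \<in> P" "z \<in> B" for B z
  proof -
    obtain i where i: "i < n" "us ! i = z" using z sub set_us len by (metis in_set_conv_nth subsetD)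
    show ?thesis
    proof (cases "i < k")
      case True
      then show ?thesis
        using us_lt i(2) same[OF os_in[OF True] z(1) _ z(2)] r[OF os_in[OF True]] by auto
    next
      case False
      then show ?thesis using tau0[of i] i b_eq[OF z] by (simp add: \<tau>_def)
    qed
  qed
  show ?thesis using f_rep[OF A(1,2)] f_rep[OF A(1,3)] by simp
qed

section \<open>Orbit partitions and the action on eigenfunctions\<close>

lemma perm_group_action:
  assumes K: "subgroup K (BijGroup X)"
  shows "group_action (perm_group X K) X (\<lambda>g. g)"
proof (rule group_action.intro)
  show "group_hom (perm_group X K) (BijGroup X) (\<lambda>g. g)"
    using group_BijGroup[of X] subgroup.subset[OF K] group.subgroup_imp_group[OF group_BijGroup K]
    by (auto simp: group_hom_def group_hom_axioms_def hom_def)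
qed

lemma (in group_action) partition_on_orbits: "partition_on E (orbits G E \<phi>)"
proof (rule partition_onI)
  show "\<Union> (orbits G E \<phi>) = E" by (rule orbits_coverture)
  show "disjnt A B" if "A \<in> orbits G E \<phi>" "B \<in> orbits G E \<phi>" "A \<noteq> B" for A B
    using disjoint_union[OF that(1,2)] that(3) by (auto simp: disjnt_def)
  show "{} \<notin> orbits G E \<phi>"
    using orbit_refl by (auto simp: orbits_def dest!: equals0D)
qed

lemma sum_arc_mult:
  assumes "finite B" shows "(\<Sum>y\<in>B. arc_mult \<Gamma> x y) = card {y \<in> B. (x, y) \<in> \<Gamma>}"
  using assms by (simp add: arc_mult_def sum.If_cases Int_def)

text \<open>Functions on vertices replace coordinate vectors so that permutations act by
  composition, independently of an ordering. The zero function is included, and values outside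
  \<open>X\<close> are unconstrained.\<close>

definition digraph_eigenfunction :: "'a set \<Rightarrow> ('a \<times> 'a) set \<Rightarrow> complex \<Rightarrow> ('a \<Rightarrow> complex) \<Rightarrow> bool" where
  "digraph_eigenfunction X \<Gamma> ev f \<longleftrightarrow>
     (\<forall>x\<in>X. (\<Sum>y\<in>X. of_nat (arc_mult \<Gamma> x y) * f y) = ev * f x)"

text \<open>Automorphisms commute with the adjacency operator: substitute \<open>g y\<close> for
  \<open>y\<close> in the sum. This action on the eigenspace is what makes its kernel
  normal.\<close>

lemma digraph_eigenfunction_compose:
  assumes K: "subgroup K (BijGroup X)" and inv: "invariant_digraph X K \<Gamma>" and g: "g \<in> K"
    and f: "digraph_eigenfunction X \<Gamma> ev f"
  shows "digraph_eigenfunction X \<Gamma> ev (\<lambda>x. f (g x))"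
  unfolding digraph_eigenfunction_def
proof
  fix x assume x: "x \<in> X"
  have bij: "bij_betw g X X" by (rule subgroup_BijGroup_bij[OF K g])
  have "(\<Sum>y\<in>X. of_nat (arc_mult \<Gamma> x y) * f (g y)) = (\<Sum>y\<in>X. of_nat (arc_mult \<Gamma> (g x) (g y)) * f (g y))"
    by (rule sum.cong) (use invariant_digraph_iff[OF K inv g x] in \<open>auto simp: arc_mult_def\<close>)
  also have "\<dots> = (\<Sum>y\<in>X. of_nat (arc_mult \<Gamma> (g x) y) * f y)"
    by (rule sum.reindex_bij_betw[OF bij])
  also have "\<dots> = ev * f (g x)"
    using f bij_betwE[OF bij] x unfolding digraph_eigenfunction_def by blast
  finally show "(\<Sum>y\<in>X. of_nat (arc_mult \<Gamma> x y) * f (g y)) = ev * f (g x)" .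
qed

lemma eigenvalue_imp_digraph_eigenfunction:
  assumes vs: "distinct vs" "set vs = X" and ev: "eigenvalue (adj_matrix vs (arc_mult \<Gamma>)) ev"
  obtains f x where "digraph_eigenfunction X \<Gamma> ev f" "x \<in> X" "f x \<noteq> 0"
proof -
  define n where "n = length vs"
  obtain v where v: "v \<in> carrier_vec n" "v \<noteq> 0\<^sub>v n" "adj_matrix vs (arc_mult \<Gamma>) *\<^sub>v v = ev \<cdot>\<^sub>v v"
    using ev unfolding eigenvalue_def eigenvector_def by (auto simp: adj_matrix_def n_def)
  have bij: "bij_betw (\<lambda>i. vs ! i) {0..<n} X"
    using bij_betw_nth[OF vs(1)] vs(2) by (simp add: n_def atLeast0LessThan)
  \<comment> \<open>The inverse of the indexing by \<open>vs\<close> reads off the entry of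
    \<open>v\<close> that belongs to a vertex.\<close>
  define f where "f x = v $ (the_inv_into {0..<n} (\<lambda>i. vs ! i) x)" for x
  have f: "f (vs ! i) = v $ i" if "i < n" for i
    using that bij the_inv_into_f_f[of "\<lambda>i. vs ! i" "{0..<n}" i] by (simp add: f_def bij_betw_def)
  have "digraph_eigenfunction X \<Gamma> ev f"
    unfolding digraph_eigenfunction_def
  proof
    fix x assume "x \<in> X"
    then obtain i where i: "i < n" "x = vs ! i" using vs(2) by (metis in_set_conv_nth n_def)
    have "(\<Sum>y\<in>X. of_nat (arc_mult \<Gamma> x y) * f y)
        = (\<Sum>j = 0..<n. of_nat (arc_mult \<Gamma> x (vs ! j)) * f (vs ! j))"
      by (rule sum.reindex_bij_betw[OF bij, symmetric])
    also have "\<dots> = (adj_matrix vs (arc_mult \<Gamma>) *\<^sub>v v) $ i"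
      using i v(1) f by (simp add: adj_matrix_def scalar_prod_def n_def)
    also have "\<dots> = ev * f x" using v i f by simp
    finally show "(\<Sum>y\<in>X. of_nat (arc_mult \<Gamma> x y) * f y) = ev * f x" .
  qed
  moreover obtain i where "i < n" "v $ i \<noteq> 0"
    using v(1,2) by (metis carrier_vecD eq_vecI index_zero_vec)
  ultimately show ?thesis using that f vs(2) n_def by (metis nth_mem)
qed

section \<open>The kernel of the action on the eigenspace\<close>

theorem theorem1p2:
  fixes X :: "'a set" and G H :: "('a \<Rightarrow> 'a) set" and \<Gamma> :: "('a \<times> 'a) set" and ev :: complex
    and vs :: "'a list" and os :: "'a set list"
  assumes "finite X"
    and "subgroup G (BijGroup X)"
    and "perm_transitive X G"
    and "subgroup H (BijGroup X)" and "H \<subseteq> G"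
    and "comm_group (perm_group X H)"
    and "semiregular X H"
    and "invariant_digraph X G \<Gamma>"
    and "distinct vs" and "set vs = X"
    and "distinct os" and "set os = perm_orbits X H"
    and "eigenvalue (adj_matrix vs (arc_mult \<Gamma>)) ev"
    and "ev \<noteq> of_nat (valency X \<Gamma>)"
    and "eig_mult (adj_matrix os (quotient_mult \<Gamma>)) ev = eig_mult (adj_matrix vs (arc_mult \<Gamma>)) ev"
  shows "\<exists>N. N \<lhd> perm_group X G \<and> H \<subseteq> N \<and> \<not> perm_transitive X N"
proof -
  interpret G: group_action "perm_group X G" X "\<lambda>g. g" by (rule perm_group_action) fact
  interpret H: group_action "perm_group X H" X "\<lambda>g. g" by (rule perm_group_action) fact
  interpret GG: group "perm_group X G" using G.group_hom group_hom.axioms(1) by blast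
  have invH: "invariant_digraph X H \<Gamma>" using assms(8) subsetD[OF assms(5)] by (simp add: invariant_digraph_def)
  have closed: "g x \<in> X" if "g \<in> G" "x \<in> X" for g x
    using G.element_image that by simp
  have comp: "(g \<otimes>\<^bsub>perm_group X G\<^esub> h) x = g (h x)" if "g \<in> G" "h \<in> G" "x \<in> X" for g h x
    using G.composition_rule that by simp
  define E where "E = {f. digraph_eigenfunction X \<Gamma> ev f}"
  \<comment> \<open>Invariance is required only at points of \<open>X\<close>, since members of
    \<open>E\<close> are arbitrary elsewhere.\<close>
  define N where "N = {g \<in> G. \<forall>f\<in>E. \<forall>x\<in>X. f (g x) = f x}"
  have N_fix: "f (g x) = f x" if "g \<in> N" "f \<in> E" "x \<in> X" for g f x
    using that by (simp add: N_def)
  have inv_app: "(inv\<^bsub>perm_group X G\<^esub> g) x \<in> X \<and> g ((inv\<^bsub>perm_group X G\<^esub> g) x) = x"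
    if g: "g \<in> G" and x: "x \<in> X" for g x
  proof -
    have "inv\<^bsub>perm_group X G\<^esub> g \<in> G" using GG.inv_closed g by simp
    then have "(inv\<^bsub>perm_group X G\<^esub> g) x \<in> X" using closed x by blast
    then show ?thesis
      using G.orbit_sym_aux[of "inv\<^bsub>perm_group X G\<^esub> g" x] GG.inv_inv[of g] GG.inv_closed[of g] g x by simp
  qed
  have subN: "subgroup N (perm_group X G)"
  proof (rule GG.subgroupI)
    show "N \<subseteq> carrier (perm_group X G)" by (auto simp: N_def)
    show "N \<noteq> {}"
    proof -
      have "\<one>\<^bsub>perm_group X G\<^esub> x = x" if "x \<in> X" for x
        using fun_cong[OF G.id_eq_one, of x] that by simp
      then have "\<one>\<^bsub>perm_group X G\<^esub> \<in> N"
        using GG.one_closed by (simp add: N_def)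
      then show ?thesis by auto
    qed
    show "inv\<^bsub>perm_group X G\<^esub> g \<in> N" if "g \<in> N" for g
    proof -
      have g: "g \<in> G" using that by (simp add: N_def)
      have "f ((inv\<^bsub>perm_group X G\<^esub> g) x) = f x" if "f \<in> E" "x \<in> X" for f x
        using N_fix[OF \<open>g \<in> N\<close> that(1), of "(inv\<^bsub>perm_group X G\<^esub> g) x"] inv_app[OF g that(2)] by simp
      then show ?thesis using GG.inv_closed[of g] g by (simp add: N_def)
    qed
    show "g \<otimes>\<^bsub>perm_group X G\<^esub> h \<in> N" if "g \<in> N" "h \<in> N" for g h
    proof -
      have gh: "g \<in> G" "h \<in> G" using that by (auto simp: N_def)
      have "f ((g \<otimes>\<^bsub>perm_group X G\<^esub> h) x) = f x" if "f \<in> E" "x \<in> X" for f x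
        using N_fix[OF \<open>g \<in> N\<close> that(1) closed[OF gh(2) that(2)]] N_fix[OF \<open>h \<in> N\<close> that]
          comp[OF gh that(2)] by simp
      then show ?thesis using GG.m_closed[of g h] gh by (simp add: N_def)
    qed
  qed
  have "N \<lhd> perm_group X G"
  proof (rule GG.normal_invI[OF subN])
    fix g h assume gh: "g \<in> carrier (perm_group X G)" "h \<in> N"
    then have g: "g \<in> G" and h: "h \<in> G" by (auto simp: N_def)
    let ?i = "inv\<^bsub>perm_group X G\<^esub> g"
    let ?c = "g \<otimes>\<^bsub>perm_group X G\<^esub> h \<otimes>\<^bsub>perm_group X G\<^esub> ?i"
    have i: "?i \<in> G" and ghG: "g \<otimes>\<^bsub>perm_group X G\<^esub> h \<in> G" and cG: "?c \<in> G"
      using GG.inv_closed[of g] GG.m_closed[of g h] GG.m_closed[of "g \<otimes>\<^bsub>perm_group X G\<^esub> h" ?i] g h by auto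
    have "f (?c x) = f x" if f: "f \<in> E" and x: "x \<in> X" for f x
    proof -
      have ix: "?i x \<in> X" "g (?i x) = x" using inv_app[OF g x] by auto
      \<comment> \<open>The kernel argument: \<open>h\<close> fixes every eigenfunction, in
        particular \<open>f\<close> composed with \<open>g\<close>. Evaluating at
        \<open>?i x\<close> cancels \<open>g\<close> against its inverse.\<close>
      have "(\<lambda>x. f (g x)) \<in> E"
        using f digraph_eigenfunction_compose[OF assms(2,8) g] by (simp add: E_def)
      then have "f (g (h (?i x))) = f (g (?i x))" using N_fix gh(2) ix(1) by blast
      then show ?thesis using comp[OF ghG i x] comp[OF g h ix(1)] ix(2) by simp
    qed
    then show "?c \<in> N" using cG unfolding N_def by blast
  qed
  moreover have "H \<subseteq> N"
  proof
    fix h assume h: "h \<in> H"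
    have "f (h x) = f x" if f: "f \<in> E" and x: "x \<in> X" for f x
    \<comment> \<open>The orbits of \<open>H\<close> are an equitable partition with quotient
      \<open>quotient_mult \<Gamma>\<close>, and \<open>x\<close> and \<open>h x\<close> lie in the
      same orbit.\<close>
    proof (rule eigenfunction_const_on_equitable_partition
        [OF assms(9-12) H.partition_on_orbits _ assms(15)])
      show "(\<Sum>y\<in>B. arc_mult \<Gamma> z y) = quotient_mult \<Gamma> A B"
        if "A \<in> perm_orbits X H" "B \<in> perm_orbits X H" "z \<in> A" for A B z
      proof -
        have "finite B"
          using that(2) H.orbits_coverture assms(1) by (metis Sup_upper finite_subset)
        then show ?thesis
          using quotient_mult_eq[OF assms(4) invH that] by (simp add: sum_arc_mult)
      qed
      show "orbit (perm_group X H) (\<lambda>g. g) x \<in> perm_orbits X H" using x by (auto simp: orbits_def)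
      show "h x \<in> orbit (perm_group X H) (\<lambda>g. g) x" using h by (auto simp: orbit_def)
    qed (use f x H.orbit_refl in \<open>auto simp: E_def digraph_eigenfunction_def\<close>)
    then show "h \<in> N" using h assms(5) unfolding N_def by blast
  qed
  moreover have "\<not> perm_transitive X N"
  proof
    assume tr: "perm_transitive X N"
    obtain f x where f: "digraph_eigenfunction X \<Gamma> ev f" and x: "x \<in> X" "f x \<noteq> 0"
      using eigenvalue_imp_digraph_eigenfunction[OF assms(9,10,13)] .
    \<comment> \<open>Transitivity of \<open>N\<close> forces \<open>f\<close> to be a nonzero
      constant on \<open>X\<close>; its eigenvalue is then the row sum at \<open>x\<close>, which is
      the valency.\<close>
    have const: "f y = f x" if y: "y \<in> X" for y
    proof -
      obtain g where "g \<in> N" "g x = y"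
        using transitive_action.unique_orbit[OF tr x(1) y] by auto
      then show ?thesis using f x(1) N_fix unfolding E_def by blast
    qed
    have out: "{y \<in> X. (x, y) \<in> \<Gamma>} = \<Gamma> `` {x}"
      using assms(8) by (auto simp: invariant_digraph_def)
    have "ev * f x = (\<Sum>y\<in>X. of_nat (arc_mult \<Gamma> x y) * f y)"
      using f x(1) by (simp add: digraph_eigenfunction_def)
    also have "\<dots> = of_nat (\<Sum>y\<in>X. arc_mult \<Gamma> x y) * f x"
      using const by (simp add: sum_distrib_right)
    also have "\<dots> = of_nat (valency X \<Gamma>) * f x"
      using sum_arc_mult[OF assms(1), of \<Gamma> x] valency_eq(1)[OF assms(1-3,8) x(1)] out by simp
    finally show False using x(2) assms(14) by simp
  qed
  ultimately show ?thesis by blast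
qed

end
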